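(* Let $X$ and $Y$ be real Banach spaces, and let $V$ and $W$ be countable dense subsets of $X$ and $Y$, respectively. Let $G$ and $H$ be geometric $1$-graphs with vertex sets $V$ and $W$. If $G$ and $H$ are isomorphic, then there is a surjective isometry between $X$ and $Y$.
   Context: For $x$ in a normed space, $B_1(x)=\{u\colon\|u-x\|<1\}$. A graph $G$ whose vertex set $V$ is a subset of a normed space is g.e.c. if for every $\delta'\in(0,1)$, every $x\in V$, and all disjoint finite $A,B\subseteq V$ with $A\cup B\subseteq B_1(x)$, there is $z\in V\setminus(A\cup B\cup\{x\})$ adjacent to every vertex of $A$ and to no vertex of $B$, with $A\cup B\subseteq B_1(z)$ and $\|x-z\|<\delta'$. $G$ has threshold $1$ if $\|u-v\|<1$ for every edge $uv$. A geometric $1$-graph is a countable graph that is g.e.c. and has threshold $1$. *)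

theory Defs
  imports
    "HOL-Analysis.Analysis"
    "Graph_Theory.Pair_Digraph"
    "Graph_Theory.Digraph_Isomorphism"
begin

text \<open>
  A simple graph, finite or infinite, is an irreflexive symmetric relation \<^term>\<open>parcs G\<close> on the
  vertex set \<^term>\<open>pverts G\<close>, that is, a \<^locale>\<open>pair_bidirected_digraph\<close>.
\<close>

definition gec :: "'a::real_normed_vector pair_pre_digraph \<Rightarrow> bool" where
  "gec G \<longleftrightarrow>
    (\<forall>\<delta>\<in>{0<..<1::real}. \<forall>x\<in>pverts G. \<forall>A B.
       finite A \<longrightarrow> finite B \<longrightarrow> A \<subseteq> pverts G \<longrightarrow> B \<subseteq> pverts G \<longrightarrow> A \<inter> B = {} \<longrightarrow>
       A \<union> B \<subseteq> ball x 1 \<longrightarrow>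
       (\<exists>z\<in>pverts G - (A \<union> B \<union> {x}).
          (\<forall>a\<in>A. (z, a) \<in> parcs G) \<and> (\<forall>b\<in>B. (z, b) \<notin> parcs G) \<and>
          A \<union> B \<subseteq> ball z 1 \<and> norm (x - z) < \<delta>))"

definition threshold_one :: "'a::real_normed_vector pair_pre_digraph \<Rightarrow> bool" where
  "threshold_one G \<longleftrightarrow> (\<forall>u v. (u, v) \<in> parcs G \<longrightarrow> norm (u - v) < 1)"

definition geometric_1_graph :: "'a::real_normed_vector pair_pre_digraph \<Rightarrow> bool" where
  "geometric_1_graph G \<longleftrightarrow>
    pair_bidirected_digraph G \<and> countable (pverts G) \<and> gec G \<and> threshold_one G"

text \<open>
  On graphs whose arcs are pairs, \<^const>\<open>digraph_iso\<close> says that some bijection of the vertex sets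
  preserves adjacency and non-adjacency.
\<close>

lemma digraph_iso_with_proj_iff:
  assumes "pair_wf_digraph G" "pair_wf_digraph H"
  shows "digraph_iso (with_proj G) (with_proj H) \<longleftrightarrow>
    (\<exists>f. bij_betw f (pverts G) (pverts H) \<and>
      (\<forall>u\<in>pverts G. \<forall>v\<in>pverts G. (u, v) \<in> parcs G \<longleftrightarrow> (f u, f v) \<in> parcs H))"
    (is "?L \<longleftrightarrow> ?R")
proof -
  interpret G: pair_wf_digraph G by fact
  interpret H: pair_wf_digraph H by fact
  show ?thesis
  proof
    assume ?L
    then obtain h where h: "pre_digraph.digraph_isomorphism (with_proj G) h"
      and H: "with_proj H = app_iso h (with_proj G)"
      unfolding digraph_iso_def by blast
    have tl: "iso_tail h = fst" and hd: "iso_head h = snd"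
      and vs: "pverts H = iso_verts h ` pverts G" and as: "parcs H = iso_arcs h ` parcs G"
      using H by (auto simp: app_iso_def with_proj_def)
    have inj: "inj_on (iso_verts h) (pverts G)"
      using h by (simp add: pre_digraph.digraph_isomorphism_def)
    have ia: "iso_arcs h (u, v) = (iso_verts h u, iso_verts h v)" if "(u, v) \<in> parcs G" for u v
      using h that tl hd by (auto simp: pre_digraph.digraph_isomorphism_def intro!: prod_eqI)
    have "(u, v) \<in> parcs G \<longleftrightarrow> (iso_verts h u, iso_verts h v) \<in> parcs H"
      if uv: "u \<in> pverts G" "v \<in> pverts G" for u v
    proof
      assume "(u, v) \<in> parcs G"
      then show "(iso_verts h u, iso_verts h v) \<in> parcs H"
        using ia as by (metis imageI)
    next
      assume "(iso_verts h u, iso_verts h v) \<in> parcs H"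
      then obtain a b where ab: "(a, b) \<in> parcs G"
        and e: "(iso_verts h u, iso_verts h v) = iso_arcs h (a, b)"
        using as by auto
      then have "iso_verts h u = iso_verts h a" "iso_verts h v = iso_verts h b"
        using ia by auto
      then have "u = a" "v = b"
        using inj uv G.in_arcsD1[OF ab] G.in_arcsD2[OF ab] by (auto dest: inj_onD)
      then show "(u, v) \<in> parcs G" using ab by simp
    qed
    then show ?R using inj vs by (auto simp: bij_betw_def intro!: exI[of _ "iso_verts h"])
  next
    assume ?R
    then obtain f where inj: "inj_on f (pverts G)" and vs: "pverts H = f ` pverts G"
      and adj: "\<And>u v. u \<in> pverts G \<Longrightarrow> v \<in> pverts G \<Longrightarrow>
        (u, v) \<in> parcs G \<longleftrightarrow> (f u, f v) \<in> parcs H"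
      unfolding bij_betw_def by blast
    define h where "h = \<lparr>iso_verts = f, iso_arcs = map_prod f f, iso_head = snd, iso_tail = fst\<rparr>"
    have "inj_on (map_prod f f) (parcs G)"
    proof (rule inj_on_subset)
      show "inj_on (map_prod f f) (pverts G \<times> pverts G)"
        by (rule map_prod_inj_on[OF inj inj])
      show "parcs G \<subseteq> pverts G \<times> pverts G"
        using G.in_arcsD1 G.in_arcsD2 by auto
    qed
    then have "pre_digraph.digraph_isomorphism (with_proj G) h"
      using inj G.wf_digraph by (simp add: pre_digraph.digraph_isomorphism_def h_def)
    moreover have "parcs H = map_prod f f ` parcs G"
    proof (intro set_eqI iffI)
      fix e assume e: "e \<in> parcs H"
      then have "fst e \<in> f ` pverts G" "snd e \<in> f ` pverts G"
        using H.arc_fst_in_verts H.arc_snd_in_verts vs by auto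
      then obtain u v where uv: "u \<in> pverts G" "v \<in> pverts G" "e = map_prod f f (u, v)"
        by (metis imageE map_prod_simp prod.collapse)
      then have "(u, v) \<in> parcs G" using e adj[OF uv(1,2)] by simp
      then show "e \<in> map_prod f f ` parcs G" using uv(3) by (rule rev_image_eqI)
    next
      fix e assume "e \<in> map_prod f f ` parcs G"
      then obtain u v where uv: "(u, v) \<in> parcs G" "e = (f u, f v)" by auto
      then show "e \<in> parcs H"
        using adj[OF G.in_arcsD1[OF uv(1)] G.in_arcsD2[OF uv(1)]] by simp
    qed
    then have "with_proj H = app_iso h (with_proj G)"
      using vs by (simp add: app_iso_def with_proj_def h_def)
    ultimately show ?L unfolding digraph_iso_def by blast
  qed
qed

end

theory Submission
  imports Defs
begin

text \<open>
  An isomorphism changes distances by at most an additive constant: two vertices at distance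
  less than \<open>k\<close> are joined by a walk of length \<open>k + 1\<close>, and a walk of length \<open>k + 1\<close> has endpoints at
  distance less than \<open>k + 1\<close>. By density it yields a correspondence \<open>R\<close> between \<open>X\<close> and \<open>Y\<close> with bounded
  distortion \<open>e\<close>.

  Vaisala's proof of the Mazur--Ulam theorem survives the distortion: composing
  a correspondence that fixes \<open>a\<close> and \<open>b\<close> with a reflected copy of its converse doubles both
  the distortion and (up to the distortion) the displacement of the midpoint, while the
  displacement is at most \<open>dist a b\<close> plus the distortion. Hence \<open>R\<close> maps midpoints to midpoints up
  to an error logarithmic in \<open>dist a b\<close>, and for \<open>(2\<^sup>n x, y\<^sub>n) \<in> R\<close> the sequence
  \<open>y\<^sub>n / 2\<^sup>n\<close> converges. The limit is an isometry in \<open>x\<close>, and it is onto because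
  the same holds for the converse of \<open>R\<close>.
\<close>

section \<open>Correspondences of bounded distortion\<close>

text \<open>A relation rather than a map, so that an inverse is available without injectivity and
  \<open>X\<close> and \<open>Y\<close> play symmetric roles.\<close>

definition correspondence :: "real \<Rightarrow> ('a::metric_space \<times> 'b::metric_space) set \<Rightarrow> bool" where
  "correspondence e R \<longleftrightarrow> Domain R = UNIV \<and> Range R = UNIV \<and>
    (\<forall>x y x' y'. (x, y) \<in> R \<longrightarrow> (x', y') \<in> R \<longrightarrow> \<bar>dist x x' - dist y y'\<bar> \<le> e)"

lemma correspondence_distortion:
  assumes "correspondence e R" "(x, y) \<in> R" "(x', y') \<in> R"
  shows "\<bar>dist x x' - dist y y'\<bar> \<le> e"
  using assms unfolding correspondence_def by blast

lemma correspondence_total: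
  assumes "correspondence e R"
  obtains y where "(x, y) \<in> R"
  using assms unfolding correspondence_def by blast

lemma correspondence_onto:
  assumes "correspondence e R"
  obtains x where "(x, y) \<in> R"
  using assms unfolding correspondence_def by blast

lemma correspondence_converse:
  assumes "correspondence e R"
  shows "correspondence e (R\<inverse>)"
  using assms unfolding correspondence_def by (auto simp: abs_minus_commute)

lemma correspondence_relcomp:
  assumes R: "correspondence d R" and S: "correspondence e S"
  shows "correspondence (d + e) (R O S)"
  unfolding correspondence_def
proof (intro conjI allI impI)
  have "\<exists>z. (x, z) \<in> R O S" for x
    by (metis relcompI correspondence_total[OF R] correspondence_total[OF S])
  then show "Domain (R O S) = UNIV" by blast
  have "\<exists>x. (x, z) \<in> R O S" for z
    by (metis relcompI correspondence_onto[OF R] correspondence_onto[OF S])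
  then show "Range (R O S) = UNIV" by blast
next
  fix x z x' z' assume "(x, z) \<in> R O S" "(x', z') \<in> R O S"
  then obtain y y' where "(x, y) \<in> R" "(y, z) \<in> S" "(x', y') \<in> R" "(y', z') \<in> S"
    by blast
  then have "\<bar>dist x x' - dist y y'\<bar> \<le> d" "\<bar>dist y y' - dist z z'\<bar> \<le> e"
    using R S by (blast intro: correspondence_distortion)+
  then show "\<bar>dist x x' - dist z z'\<bar> \<le> d + e" by linarith
qed

section \<open>Approximate preservation of midpoints\<close>

text \<open>The point reflection in the midpoint of \<open>a\<close> and \<open>b\<close>, which
  swaps \<open>a\<close> and \<open>b\<close>; as a relation it composes with
  correspondences.\<close>

definition reflection :: "'a::real_normed_vector \<Rightarrow> 'a \<Rightarrow> ('a \<times> 'a) set" where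
  "reflection a b = {(x, y). x + y = a + b}"

lemma correspondence_reflection: "correspondence 0 (reflection a b)"
proof -
  have "dist x x' = dist y y'" if "x + y = a + b" "x' + y' = a + b" for x y x' y' :: 'a
  proof -
    have "x - x' = y' - y"
      using that by (metis add_diff_cancel_left add_diff_cancel_right' diff_diff_eq2 add.commute)
    then show ?thesis by (simp add: dist_norm norm_minus_commute)
  qed
  moreover have "\<exists>y. x + y = a + b" "\<exists>y. y + x = a + b" for x :: 'a
    by (rule exI[of _ "a + b - x"]; simp)+
  ultimately show ?thesis
    unfolding correspondence_def reflection_def
    by auto
qed

lemma dist_reflect_midpoint:
  fixes a b u :: "'a::real_normed_vector"
  shows "dist (a + b - u) (midpoint a b) = dist u (midpoint a b)"
proof -
  have "a + b - u - midpoint a b = midpoint a b - u"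
    by (simp add: midpoint_def algebra_simps flip: scaleR_2)
  then show ?thesis unfolding dist_norm by (simp only: norm_minus_commute)
qed

lemma dist_reflect_self:
  fixes a b u :: "'a::real_normed_vector"
  shows "dist (a + b - u) u = 2 * dist u (midpoint a b)"
proof -
  have "a + b - u - u = 2 *\<^sub>R (midpoint a b - u)"
    by (simp add: midpoint_def algebra_simps flip: scaleR_2)
  then show ?thesis
    unfolding dist_norm by (simp only: norm_scaleR abs_numeral norm_minus_commute)
qed

text \<open>Each induction step applies the bound for \<open>n\<close> with distortion
  \<open>2 * e\<close>, adds \<open>e\<close> and halves: the doubled distortion is restored and
  \<open>e / 2\<close> is gained. Hence \<open>R\<close> and \<open>e\<close> must vary in the
  induction.\<close>

lemma midpoint_displacement_le:
  fixes R :: "('a::real_normed_vector \<times> 'a) set"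
  assumes "correspondence e R" "(a, a) \<in> R" "(b, b) \<in> R" "(midpoint a b, w) \<in> R"
  shows "dist w (midpoint a b) \<le> dist a b / 2 ^ n + e * (1 + n / 2)"
  using assms
proof (induction n arbitrary: R e w)
  case 0
  have "\<bar>dist a (midpoint a b) - dist a w\<bar> \<le> e"
    using 0 by (blast intro: correspondence_distortion)
  moreover have "dist w (midpoint a b) \<le> dist a w + dist a (midpoint a b)"
    by (rule dist_triangle3)
  ultimately show ?case by (simp add: dist_midpoint)
next
  case (Suc n)
  define R' where "R' = R O reflection a b O R\<inverse> O reflection a b"
  have "correspondence (e + (0 + (e + 0))) R'"
    unfolding R'_def
    by (intro correspondence_relcomp correspondence_reflection correspondence_converse Suc.prems)
  then have R': "correspondence (2 * e) R'" by simp
  \<comment> \<open>\<open>R'\<close> moves the midpoint through \<open>w\<close>,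
    \<open>a + b - w\<close> and \<open>u\<close> to \<open>a + b - u\<close>.\<close>
  obtain u where u: "(u, a + b - w) \<in> R"
    using Suc.prems(1) by (rule correspondence_onto)
  have "(a, a) \<in> R'" "(b, b) \<in> R'"
    using Suc.prems unfolding R'_def reflection_def by (auto simp: relcomp_unfold add.commute)
  moreover have "(midpoint a b, a + b - u) \<in> R'"
    unfolding R'_def
    by (intro relcompI[OF Suc.prems(4)] relcompI[where b = "a + b - w"] relcompI[where b = u])
      (simp_all add: reflection_def u)
  ultimately have "dist (a + b - u) (midpoint a b) \<le> dist a b / 2 ^ n + 2 * e * (1 + n / 2)"
    by (rule Suc.IH[OF R'])
  then have *: "dist u (midpoint a b) \<le> dist a b / 2 ^ n + 2 * e * (1 + n / 2)"
    by (simp only: dist_reflect_midpoint)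
  \<comment> \<open>The second distance is twice the displacement of \<open>w\<close>; this is where
    the displacement doubles.\<close>
  have "\<bar>dist u (midpoint a b) - dist (a + b - w) w\<bar> \<le> e"
    using Suc.prems(1) u Suc.prems(4) by (rule correspondence_distortion)
  then have "2 * dist w (midpoint a b) \<le> dist a b / 2 ^ n + 2 * e * (1 + n / 2) + e"
    using * by (simp add: dist_reflect_self)
  then show ?case by (simp add: field_simps)
qed

text \<open>The same argument with the first reflection taken in the codomain, about
  \<open>midpoint a' b'\<close>: the composite \<open>S\<close> fixes \<open>a\<close> and
  \<open>b\<close> although \<open>R\<close> need not, so the previous bound applies to it.\<close>

lemma dist_midpoint_image_le:
  fixes R :: "('a::real_normed_vector \<times> 'b::real_normed_vector) set"
  assumes R: "correspondence e R"
    and a: "(a, a') \<in> R" and b: "(b, b') \<in> R" and z: "(midpoint a b, z') \<in> R"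
  shows "dist z' (midpoint a' b') \<le> dist a b / 2 ^ Suc n + e * (3 + n) / 2"
proof -
  define S where "S = R O reflection a' b' O R\<inverse> O reflection a b"
  have "correspondence (e + (0 + (e + 0))) S"
    unfolding S_def
    by (intro correspondence_relcomp correspondence_reflection correspondence_converse R)
  then have S: "correspondence (2 * e) S" by simp
  obtain u where u: "(u, a' + b' - z') \<in> R"
    using R by (rule correspondence_onto)
  have "(a, a) \<in> S"
    unfolding S_def by (intro relcompI[OF a] relcompI[where b = b'] relcompI[where b = b])
      (simp_all add: reflection_def b add.commute)
  moreover have "(b, b) \<in> S"
    unfolding S_def by (intro relcompI[OF b] relcompI[where b = a'] relcompI[where b = a])
      (simp_all add: reflection_def a add.commute)
  moreover have "(midpoint a b, a + b - u) \<in> S"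
    unfolding S_def
    by (intro relcompI[OF z] relcompI[where b = "a' + b' - z'"] relcompI[where b = u])
      (simp_all add: reflection_def u)
  ultimately have "dist (a + b - u) (midpoint a b) \<le> dist a b / 2 ^ n + 2 * e * (1 + n / 2)"
    by (rule midpoint_displacement_le[OF S])
  then have *: "dist u (midpoint a b) \<le> dist a b / 2 ^ n + 2 * e * (1 + n / 2)"
    by (simp only: dist_reflect_midpoint)
  have "\<bar>dist u (midpoint a b) - dist (a' + b' - z') z'\<bar> \<le> e"
    using R u z by (rule correspondence_distortion)
  then have "2 * dist z' (midpoint a' b') \<le> dist a b / 2 ^ n + 2 * e * (1 + n / 2) + e"
    using * by (simp add: dist_reflect_self)
  then show ?thesis by (simp add: field_simps)
qed

section \<open>The limit of rescalings\<close>

lemma summable_linear_over_power2: "summable (\<lambda>n. (c + d * real n) / 2 ^ n)"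
proof -
  \<comment> \<open>Chosen so that \<open>t n - t (Suc n)\<close> is exactly the given term.\<close>
  define t where "t n = (2 * c + 2 * d + 2 * d * real n) / 2 ^ n" for n
  have "t \<longlonglongrightarrow> 0" unfolding t_def by real_asymp
  then have "summable (\<lambda>n. t n - t (Suc n))" by (rule telescope_summable')
  moreover have "t n - t (Suc n) = (c + d * real n) / 2 ^ n" for n
    unfolding t_def by (simp add: field_simps)
  ultimately show ?thesis by simp
qed

text \<open>As \<open>2 ^ n *\<^sub>R x\<close> is the midpoint of \<open>0\<close> and its double,
  \<open>y n\<close> is near half of \<open>y (Suc n)\<close>. The error is linear in
  \<open>n\<close>, hence summable after division by \<open>2 ^ n\<close>, and completeness of the
  codomain gives the limit.\<close>

lemma correspondence_rescaled_convergent: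
  fixes R :: "('a::real_normed_vector \<times> 'b::banach) set"
  assumes R: "correspondence e R" and y: "\<And>n. (2 ^ n *\<^sub>R x, y n) \<in> R"
  shows "convergent (\<lambda>n. y n /\<^sub>R 2 ^ n)"
proof -
  obtain y0 where y0: "(0, y0) \<in> R" using R by (rule correspondence_total)
  define s where "s n = y n /\<^sub>R 2 ^ n" for n
  \<comment> \<open>The last summand accounts for \<open>0\<close> corresponding to
    \<open>y0\<close> instead of \<open>0\<close>.\<close>
  define c where "c = norm x + 3 * e / 2 + norm y0 / 2"
  have bound: "norm (s (Suc n) - s n) \<le> (c + e / 2 * n) / 2 ^ n" for n
  proof -
    have "(midpoint 0 (2 ^ Suc n *\<^sub>R x), y n) \<in> R"
      using y[of n] by (simp add: midpoint_def)
    \<comment> \<open>The free exponent is taken to be \<open>n\<close>, so that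
      \<open>2 ^ Suc n\<close> cancels and only \<open>norm x\<close> remains.\<close>
    then have "dist (y n) (midpoint y0 (y (Suc n)))
        \<le> dist 0 (2 ^ Suc n *\<^sub>R x) / 2 ^ Suc n + e * (3 + n) / 2"
      by (rule dist_midpoint_image_le[OF R y0 y])
    also have "\<dots> = norm x + e * (3 + n) / 2" by simp
    finally have 1: "norm (midpoint y0 (y (Suc n)) - y n) \<le> norm x + e * (3 + n) / 2"
      by (simp add: dist_norm norm_minus_commute)
    have "y (Suc n) /\<^sub>R 2 - y n = (midpoint y0 (y (Suc n)) - y n) - y0 /\<^sub>R 2"
      by (simp add: midpoint_def algebra_simps)
    then have "norm (y (Suc n) /\<^sub>R 2 - y n)
        \<le> norm (midpoint y0 (y (Suc n)) - y n) + norm (y0 /\<^sub>R 2)"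
      by (metis norm_triangle_ineq4)
    with 1 have 2: "norm (y (Suc n) /\<^sub>R 2 - y n) \<le> c + e / 2 * n"
      by (simp add: c_def field_simps)
    have "s (Suc n) - s n = (y (Suc n) /\<^sub>R 2 - y n) /\<^sub>R 2 ^ n"
      by (simp add: s_def algebra_simps)
    moreover have "norm (u /\<^sub>R 2 ^ n) = norm u / 2 ^ n" for u :: 'b
      by (simp add: divide_inverse mult.commute)
    ultimately have "norm (s (Suc n) - s n) = norm (y (Suc n) /\<^sub>R 2 - y n) / 2 ^ n"
      by metis
    also have "\<dots> \<le> (c + e / 2 * n) / 2 ^ n"
      using 2 by (rule divide_right_mono) simp
    finally show ?thesis .
  qed
  have "summable (\<lambda>n. s (Suc n) - s n)"
    by (rule summable_comparison_test'[OF summable_linear_over_power2 bound])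
  then have "convergent (\<lambda>n. \<Sum>i<n. s (Suc i) - s i)"
    by (simp add: summable_iff_convergent)
  then have "convergent (\<lambda>n. s n - s 0)" by (simp add: sum_lessThan_telescope)
  then have "convergent s" by (simp add: convergent_diff_const_right_iff)
  then show ?thesis unfolding s_def .
qed

theorem correspondence_imp_isometry:
  fixes R :: "('a::banach \<times> 'b::banach) set"
  assumes R: "correspondence e R"
  shows "\<exists>T :: 'a \<Rightarrow> 'b. surj T \<and> (\<forall>x y. dist (T x) (T y) = dist x y)"
proof -
  have "\<forall>x. \<exists>y. (x, y) \<in> R" by (metis correspondence_total[OF R])
  then obtain f where f: "\<And>x. (x, f x) \<in> R" by metis
  have "\<forall>y. \<exists>x. (x, y) \<in> R" by (metis correspondence_onto[OF R])
  then obtain g where g: "\<And>y. (g y, y) \<in> R" by metis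
  define s where "s x n = f (2 ^ n *\<^sub>R x) /\<^sub>R 2 ^ n" for x n
  define t where "t y n = g (2 ^ n *\<^sub>R y) /\<^sub>R 2 ^ n" for y n
  define T where "T x = lim (s x)" for x
  have T: "s x \<longlonglongrightarrow> T x" for x
    unfolding T_def s_def convergent_LIMSEQ_iff[symmetric]
    using R f by (rule correspondence_rescaled_convergent)
  have "convergent (t y)" for y
    unfolding t_def using correspondence_converse[OF R]
    by (rule correspondence_rescaled_convergent[where x = y]) (simp add: g)
  then obtain U where U: "\<And>y. t y \<longlonglongrightarrow> U y"
    unfolding convergent_def by metis
  have e_lim: "(\<lambda>n. e / 2 ^ n) \<longlonglongrightarrow> 0" by real_asymp
  have dist_scaled: "dist (u /\<^sub>R 2 ^ n) (v /\<^sub>R 2 ^ n) = dist u v / 2 ^ n"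
    for u v :: "'c::real_normed_vector" and n
    by (simp add: dist_norm divide_inverse flip: scaleR_diff_right)
  have scale: "\<bar>dist (u /\<^sub>R 2 ^ n) (u' /\<^sub>R 2 ^ n) - dist (v /\<^sub>R 2 ^ n) (v' /\<^sub>R 2 ^ n)\<bar> \<le> e / 2 ^ n"
    if "(u, v) \<in> R" "(u', v') \<in> R" for u u' v v' n
  proof -
    have "\<bar>dist u u' / 2 ^ n - dist v v' / 2 ^ n\<bar> = \<bar>dist u u' - dist v v'\<bar> / 2 ^ n"
      by (simp add: diff_divide_distrib[symmetric])
    then show ?thesis
      using correspondence_distortion[OF R that] by (simp add: dist_scaled divide_right_mono)
  qed
  have "dist (T x) (T x') = dist x x'" for x x'
  proof -
    have "\<bar>dist x x' - dist (s x n) (s x' n)\<bar> \<le> e / 2 ^ n" for n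
      using scale[OF f[of "2 ^ n *\<^sub>R x"] f[of "2 ^ n *\<^sub>R x'"], of n] by (simp add: s_def)
    moreover have "(\<lambda>n. \<bar>dist x x' - dist (s x n) (s x' n)\<bar>)
        \<longlonglongrightarrow> \<bar>dist x x' - dist (T x) (T x')\<bar>"
      by (intro tendsto_intros T)
    ultimately have "\<bar>dist x x' - dist (T x) (T x')\<bar> \<le> 0"
      using e_lim by (blast intro: LIMSEQ_le)
    then show ?thesis by simp
  qed
  moreover have "T (U y) = y" for y
  proof -
    \<comment> \<open>Compares the pairs of \<open>R\<close> through
      \<open>2 ^ n *\<^sub>R U y\<close> on the left and \<open>2 ^ n *\<^sub>R y\<close> on the
      right. Since \<open>t y n\<close> tends to \<open>U y\<close>, the other distance must vanish
      as well.\<close>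
    have "\<bar>dist (U y) (t y n) - dist (s (U y) n) y\<bar> \<le> e / 2 ^ n" for n
      using scale[OF f[of "2 ^ n *\<^sub>R U y"] g[of "2 ^ n *\<^sub>R y"], of n] by (simp add: s_def t_def)
    moreover have "(\<lambda>n. \<bar>dist (U y) (t y n) - dist (s (U y) n) y\<bar>)
        \<longlonglongrightarrow> \<bar>dist (U y) (U y) - dist (T (U y)) y\<bar>"
      by (intro tendsto_intros T U)
    ultimately have "\<bar>dist (U y) (U y) - dist (T (U y)) y\<bar> \<le> 0"
      using e_lim by (blast intro: LIMSEQ_le)
    then show ?thesis by simp
  qed
  ultimately show ?thesis by (metis surjI)
qed

section \<open>Distances along walks in the graph\<close>

lemma dense_near:
  fixes V :: "'a::real_normed_vector set"
  assumes "closure V = UNIV" "0 < d"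
  obtains v where "v \<in> V" "dist x v < d"
  using assms by (metis UNIV_I closure_approachable dist_commute)

lemma dense_between:
  fixes u v :: "'a::real_normed_vector"
  assumes V: "closure V = UNIV" and uv: "dist u v < r + 1" and r: "0 < r"
  obtains x where "x \<in> V" "dist u x < 1" "dist x v < r"
proof -
  \<comment> \<open>\<open>p\<close> divides the segment in the ratio \<open>1 : r\<close>, which
    leaves slack at both ends for moving it into \<open>V\<close>.\<close>
  define p where "p = u + (1 / (r + 1)) *\<^sub>R (v - u)"
  have "p - u = (1 / (r + 1)) *\<^sub>R (v - u)" by (simp add: p_def)
  then have "norm (p - u) = norm (v - u) / (r + 1)" using r by simp
  then have "dist u p = dist u v / (r + 1)" by (simp add: dist_norm norm_minus_commute)
  then have up: "dist u p < 1" using uv r by simp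
  have "v - p = (1 - 1 / (r + 1)) *\<^sub>R (v - u)" by (simp add: p_def algebra_simps)
  also have "1 - 1 / (r + 1) = r / (r + 1)" using r by (simp add: field_simps)
  finally have "norm (v - p) = r / (r + 1) * norm (v - u)" using r by simp
  then have "dist p v = r / (r + 1) * dist u v" by (simp add: dist_norm norm_minus_commute)
  also have "\<dots> < r / (r + 1) * (r + 1)" using uv r by (intro mult_strict_left_mono) auto
  finally have pv: "dist p v < r" using r by simp
  obtain x where x: "x \<in> V" "dist p x < min (1 - dist u p) (r - dist p v)"
    using dense_near[OF V, of "min (1 - dist u p) (r - dist p v)"] up pv by auto
  show ?thesis
    using x dist_triangle[of u x p] dist_triangle3[of x v p] by (intro that[of x]) auto
qed

lemma gec_common_neighbour:
  assumes "gec G" "u \<in> pverts G" "v \<in> pverts G" "dist u v < 1"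
  obtains z where "z \<in> pverts G" "(z, u) \<in> parcs G" "(z, v) \<in> parcs G"
proof -
  have "\<exists>z\<in>pverts G - ({u, v} \<union> {} \<union> {u}).
      (\<forall>a\<in>{u, v}. (z, a) \<in> parcs G) \<and> (\<forall>b\<in>{}. (z, b) \<notin> parcs G) \<and>
      {u, v} \<union> {} \<subseteq> ball z 1 \<and> norm (u - z) < 1 / 2"
    by (rule assms(1)[unfolded gec_def, rule_format]) (use assms in auto)
  then show ?thesis using that by auto
qed

text \<open>A vertex \<open>x\<close> within distance 1 of \<open>u\<close> need not be adjacent to
  \<open>u\<close>, but it can be traded for a neighbour of \<open>u\<close> arbitrarily close
  by.\<close>

lemma gec_neighbour_near:
  assumes "gec G" "u \<in> pverts G" "x \<in> pverts G" "dist u x < 1" "0 < d"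
  obtains z where "z \<in> pverts G" "(z, u) \<in> parcs G" "dist x z < d"
proof -
  have "\<exists>z\<in>pverts G - ({u} \<union> {} \<union> {x}).
      (\<forall>a\<in>{u}. (z, a) \<in> parcs G) \<and> (\<forall>b\<in>{}. (z, b) \<notin> parcs G) \<and>
      {u} \<union> {} \<subseteq> ball z 1 \<and> norm (x - z) < min d (1 / 2)"
    by (rule assms(1)[unfolded gec_def, rule_format]) (use assms in \<open>auto simp: dist_commute\<close>)
  then show ?thesis using that by (auto simp: dist_norm)
qed

text \<open>The walk has \<open>k + 2\<close> edges: a common neighbour gives two edges when
  \<open>k = 0\<close>, and each further unit of distance costs one edge, whose end \<open>z\<close>
  is close enough to the intermediate \<open>x\<close> to keep
  \<open>dist z v < Suc k\<close>.\<close>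

lemma gec_edge_contraction_dist_less:
  fixes f :: "'a::real_normed_vector \<Rightarrow> 'b::metric_space"
  assumes G: "gec G" and dense: "closure (pverts G) = UNIV"
    and f: "\<And>u v. (u, v) \<in> parcs G \<Longrightarrow> dist (f u) (f v) < 1"
    and "u \<in> pverts G" "v \<in> pverts G" "dist u v < Suc k"
  shows "dist (f u) (f v) < k + 2"
  using assms(4-)
proof (induction k arbitrary: u)
  case 0
  then obtain z where "z \<in> pverts G" "(z, u) \<in> parcs G" "(z, v) \<in> parcs G"
    using gec_common_neighbour[OF G, of u v] by auto
  then show ?case
    using f[of z u] f[of z v] dist_triangle3[of "f u" "f v" "f z"] by simp
next
  case (Suc k)
  have "dist u v < real (Suc k) + 1" using Suc.prems by simp
  then obtain x where x: "x \<in> pverts G" "dist u x < 1" "dist x v < Suc k"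
    by (rule dense_between[OF dense]) auto
  obtain z where z: "z \<in> pverts G" "(z, u) \<in> parcs G" "dist x z < Suc k - dist x v"
    using gec_neighbour_near[OF G Suc.prems(1) x(1,2), of "Suc k - dist x v"] x(3) by auto
  have "dist z v < Suc k" using z(3) dist_triangle3[of z v x] by linarith
  then have "dist (f z) (f v) < k + 2" by (rule Suc.IH[OF z(1) Suc.prems(2)])
  then show ?case
    using f[OF z(2)] dist_triangle3[of "f u" "f v" "f z"] by simp
qed

lemma gec_edge_contraction_dist_le:
  fixes f :: "'a::real_normed_vector \<Rightarrow> 'b::metric_space"
  assumes "gec G" "closure (pverts G) = UNIV"
    and "\<And>u v. (u, v) \<in> parcs G \<Longrightarrow> dist (f u) (f v) < 1"
    and "u \<in> pverts G" "v \<in> pverts G"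
  shows "dist (f u) (f v) \<le> dist u v + 2"
proof -
  define k where "k = nat \<lfloor>dist u v\<rfloor>"
  have "real k \<le> dist u v" "dist u v < Suc k"
    unfolding k_def by (simp, linarith)
  then show ?thesis
    using gec_edge_contraction_dist_less[where f = f and k = k, OF assms] by linarith
qed

text \<open>Points are related through a vertex near both, so \<open>f\<close> need not extend
  continuously. The four approximations, each with error below 1, add up to the extra 4.\<close>

lemma dense_correspondence:
  fixes f :: "'a::real_normed_vector \<Rightarrow> 'b::real_normed_vector"
  assumes V: "closure V = UNIV" and W: "closure (f ` V) = UNIV"
    and f: "\<And>u v. u \<in> V \<Longrightarrow> v \<in> V \<Longrightarrow> \<bar>dist u v - dist (f u) (f v)\<bar> \<le> e"
  shows "correspondence (e + 4) {(x, y). \<exists>v\<in>V. dist x v < 1 \<and> dist y (f v) < 1}"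
    (is "correspondence _ ?R")
  unfolding correspondence_def
proof (intro conjI allI impI)
  have "\<exists>y. (x, y) \<in> ?R" for x
  proof -
    obtain v where "v \<in> V" "dist x v < 1" using dense_near[OF V, of 1 x] by auto
    then show ?thesis by (intro exI[of _ "f v"]) auto
  qed
  then show "Domain ?R = UNIV" by blast
  have "\<exists>x. (x, y) \<in> ?R" for y
  proof -
    obtain v where "v \<in> V" "dist y (f v) < 1" using dense_near[OF W, of 1 y] by auto
    then show ?thesis by (intro exI[of _ v]) (auto intro!: bexI[of _ v])
  qed
  then show "Range ?R = UNIV" by blast
next
  fix x y x' y' assume "(x, y) \<in> ?R" "(x', y') \<in> ?R"
  then obtain v v' where v: "v \<in> V" "dist x v < 1" "dist y (f v) < 1"
    and v': "v' \<in> V" "dist x' v' < 1" "dist y' (f v') < 1" by auto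
  have near: "\<bar>dist p p' - dist q q'\<bar> \<le> dist p q + dist p' q'" for p p' q q' :: "'c::metric_space"
    using dist_triangle[of p p' q] dist_triangle[of q p' q']
      dist_triangle3[of q q' p] dist_triangle[of p q' p']
    by (simp add: dist_commute)
  show "\<bar>dist x x' - dist y y'\<bar> \<le> e + 4"
    using near[of x x' v v'] near[of y y' "f v" "f v'"] f[OF v(1) v'(1)] v v' by linarith
qed

theorem theorem6p2:
  fixes V :: "'a::banach set" and W :: "'b::banach set"
    and G :: "'a pair_pre_digraph" and H :: "'b pair_pre_digraph"
  assumes "countable V" and "closure V = UNIV"
    and "countable W" and "closure W = UNIV"
    and "geometric_1_graph G" and "pverts G = V"
    and "geometric_1_graph H" and "pverts H = W"
    and "digraph_iso (with_proj G) (with_proj H)"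
  shows "\<exists>T :: 'a \<Rightarrow> 'b. surj T \<and> (\<forall>x y. dist (T x) (T y) = dist x y)"
proof -
  interpret G: pair_bidirected_digraph G
    using assms(5) by (simp add: geometric_1_graph_def)
  interpret H: pair_bidirected_digraph H
    using assms(7) by (simp add: geometric_1_graph_def)
  have G: "gec G" "threshold_one G" and H: "gec H" "threshold_one H"
    using assms(5,7) by (simp_all add: geometric_1_graph_def)
  obtain f where bij: "bij_betw f V W"
    and adj: "\<And>u v. u \<in> V \<Longrightarrow> v \<in> V \<Longrightarrow> (u, v) \<in> parcs G \<longleftrightarrow> (f u, f v) \<in> parcs H"
    using assms(9) digraph_iso_with_proj_iff[OF G.pair_wf_digraph_axioms H.pair_wf_digraph_axioms]
    unfolding assms(6,8) by blast
  define g where "g = inv_into V f"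
  have gf: "g (f v) = v" if "v \<in> V" for v
    using bij that by (simp add: g_def bij_betw_def)
  have fg: "g w \<in> V" "f (g w) = w" if "w \<in> W" for w
    using bij that by (auto simp: g_def bij_betw_def f_inv_into_f inv_into_into)
  have f_le: "dist (f u) (f v) \<le> dist u v + 2" if "u \<in> V" "v \<in> V" for u v
  proof (rule gec_edge_contraction_dist_le[OF G(1)])
    fix u v assume uv: "(u, v) \<in> parcs G"
    then have "(f u, f v) \<in> parcs H"
      using adj G.in_arcsD1[OF uv] G.in_arcsD2[OF uv] assms(6) by auto
    then show "dist (f u) (f v) < 1" using H(2) by (simp add: threshold_one_def dist_norm)
  qed (use that assms in auto)
  \<comment> \<open>The lower bound on \<open>dist (f u) (f v)\<close> comes from the inverse, which
    also maps edges to edges because \<open>f\<close> preserves non-adjacency.\<close>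
  have g_le: "dist (g u) (g v) \<le> dist u v + 2" if "u \<in> W" "v \<in> W" for u v
  proof (rule gec_edge_contraction_dist_le[OF H(1)])
    fix u v assume uv: "(u, v) \<in> parcs H"
    then have "u \<in> W" "v \<in> W"
      using H.in_arcsD1[OF uv] H.in_arcsD2[OF uv] assms(8) by auto
    then have "(g u, g v) \<in> parcs G" using uv adj fg by simp
    then show "dist (g u) (g v) < 1" using G(2) by (simp add: threshold_one_def dist_norm)
  qed (use that assms in auto)
  have fV: "f ` V = W" using bij by (simp add: bij_betw_def)
  have "\<bar>dist u v - dist (f u) (f v)\<bar> \<le> 2" if "u \<in> V" "v \<in> V" for u v
    using f_le[OF that] g_le[of "f u" "f v"] gf that fV by auto
  then show ?thesis
    using assms(2,4) fV by (blast intro: correspondence_imp_isometry dense_correspondence)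
qed

end
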